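(* Let $1\le n\le N$, let $\Lambda$ be a positive definite diagonal $N\times N$ real matrix, and let $k$ be a constant symmetric real $n\times n$ matrix. The extremal trajectories $(Q,P)\in W^k_{n,N}$ of the optimal control problem $$\min_{U(\cdot)}\int_0^T\tfrac12\langle QU\Lambda,QU\rangle\,dt\quad\text{subject to }\dot Q=QU,\ QQ^{\mathsf T}=I_n,\ Q(0)=Q_0,\ Q(T)=Q_T,\ U\in\mathfrak{so}(N),$$ are given by $$\dot Q=QU,\quad U\in\mathfrak{so}(N),\qquad \dot P=PU-QA,$$ where $A=Q^{\mathsf T}Q\,U\Lambda U-U\Lambda U\,Q^{\mathsf T}Q$.
   Context: $\mathbb R^{nN}$ denotes the real $n\times N$ matrices; $\langle A,B\rangle=\operatorname{Tr}(A^{\mathsf T}B)$; $\mathfrak{so}(N)$ is the space of real skew-symmetric $N\times N$ matrices. $W^k_{n,N}=\{(Q,P)\in\mathbb R^{nN}\times\mathbb R^{nN}: QQ^{\mathsf T}=I_n,\ QP^{\mathsf T}+PQ^{\mathsf T}=k\}$, which is a symplectic submanifold of $\mathbb R^{nN}\times\mathbb R^{nN}$ with symplectic form $\Omega$ the restriction of $\omega((A_1,A_2),(B_1,B_2))=\langle A_1,B_2\rangle-\langle A_2,B_1\rangle$. Its tangent vectors at $(Q,P)$ are the pairs $(QU_1,PU_1+QV_1)$ with $U_1,V_1\in\mathfrak{so}(N)$. The Hamiltonian of the problem is $H(P,Q,U)=\langle P,QU\rangle-\tfrac12\langle QU\Lambda,QU\rangle=\langle P,QU\rangle+\tfrac12\langle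 Q^{\mathsf T}Q,U\Lambda U\rangle$. An extremal trajectory in $W^k_{n,N}$ is a smooth curve $(Q(t),P(t))\in W^k_{n,N}$ together with a control $U(t)\in\mathfrak{so}(N)$ such that, at each time, (i) $(\dot Q,\dot P)=X_H(Q,P)$, where $X_H$ is the Hamiltonian vector field on $(W^k_{n,N},\Omega)$ of the function $H(\cdot,\cdot,U)$ with $U$ held fixed, i.e. $dH(X_2)=\Omega(X_H,X_2)$ for all tangent vectors $X_2$; and (ii) $U$ is the optimal control given by the maximum principle $\mathrm{Grad}_U H=0$ on $\mathfrak{so}(N)$, i.e. $Q^{\mathsf T}P-P^{\mathsf T}Q=Q^{\mathsf T}QU\Lambda+\Lambda UQ^{\mathsf T}Q$. *)

theory Defs
  imports "HOL-Analysis.Analysis"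
begin

(* An n x N real matrix has type real^'m^'n with CARD('n) = n and CARD('m) = N. *)

definition mat_inner :: "real^'m^'n \<Rightarrow> real^'m^'n \<Rightarrow> real" where
  "mat_inner A B = trace (transpose A ** B)"

definition skew_matrices :: "(real^'m^'m) set" where
  "skew_matrices = {U. transpose U = - U}"

definition symmetric_matrix :: "real^'n^'n \<Rightarrow> bool" where
  "symmetric_matrix A \<longleftrightarrow> transpose A = A"

definition diagonal_matrix :: "real^'m^'m \<Rightarrow> bool" where
  "diagonal_matrix A \<longleftrightarrow> (\<forall>i j. i \<noteq> j \<longrightarrow> A $ i $ j = 0)"

definition positive_definite :: "real^'m^'m \<Rightarrow> bool" where
  "positive_definite A \<longleftrightarrow> symmetric_matrix A \<and> (\<forall>x. x \<noteq> 0 \<longrightarrow> x \<bullet> (A *v x) > 0)"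

definition W :: "real^'n^'n \<Rightarrow> ((real^'m^'n) \<times> (real^'m^'n)) set" where
  "W k = {(Q, P). Q ** transpose Q = mat 1 \<and> Q ** transpose P + P ** transpose Q = k}"

definition W_tangent :: "(real^'m^'n) \<times> (real^'m^'n) \<Rightarrow> ((real^'m^'n) \<times> (real^'m^'n)) set" where
  "W_tangent = (\<lambda>(Q, P).
     {(Q ** U, P ** U + Q ** V) | U V. U \<in> skew_matrices \<and> V \<in> skew_matrices})"

definition sympl_form ::
    "(real^'m^'n) \<times> (real^'m^'n) \<Rightarrow> (real^'m^'n) \<times> (real^'m^'n) \<Rightarrow> real" where
  "sympl_form = (\<lambda>(A1, A2) (B1, B2). mat_inner A1 B2 - mat_inner A2 B1)"

definition running_cost :: "real^'m^'m \<Rightarrow> real^'m^'n \<Rightarrow> real^'m^'m \<Rightarrow> real" where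
  "running_cost \<Lambda> Q U = 1/2 * mat_inner (Q ** U ** \<Lambda>) (Q ** U)"

definition hamiltonian ::
    "real^'m^'m \<Rightarrow> real^'m^'n \<Rightarrow> real^'m^'n \<Rightarrow> real^'m^'m \<Rightarrow> real" where
  "hamiltonian \<Lambda> P Q U = mat_inner P (Q ** U) - running_cost \<Lambda> Q U"

(* X is the value at z of the Hamiltonian vector field on W of a function F, where F is given on
   the ambient space; the differential of F restricted to W is that of F on tangent vectors. *)
definition is_hamiltonian_vector ::
    "((real^'m^'n) \<times> (real^'m^'n) \<Rightarrow> real) \<Rightarrow> (real^'m^'n) \<times> (real^'m^'n) \<Rightarrow>
     (real^'m^'n) \<times> (real^'m^'n) \<Rightarrow> bool" where
  "is_hamiltonian_vector F z X \<longleftrightarrow>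
     X \<in> W_tangent z \<and>
     (\<forall>Y \<in> W_tangent z. frechet_derivative F (at z) Y = sympl_form X Y)"

(* G is the gradient at U, with respect to mat_inner, of f restricted to the space of skew
   matrices. *)
definition is_gradient_on_skew ::
    "(real^'m^'m \<Rightarrow> real) \<Rightarrow> real^'m^'m \<Rightarrow> real^'m^'m \<Rightarrow> bool" where
  "is_gradient_on_skew f U G \<longleftrightarrow>
     G \<in> skew_matrices \<and>
     (\<forall>V \<in> skew_matrices. frechet_derivative f (at U) V = mat_inner G V)"

(* C-infinity on the closed interval, with one-sided derivatives at the end points. *)
definition smooth_curve_on :: "real set \<Rightarrow> (real \<Rightarrow> 'a::real_normed_vector) \<Rightarrow> bool" where
  "smooth_curve_on I f \<longleftrightarrow>
     (\<exists>D :: nat \<Rightarrow> real \<Rightarrow> 'a. (\<forall>t\<in>I. D 0 t = f t) \<and>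
        (\<forall>i. \<forall>t\<in>I. (D i has_vector_derivative D (Suc i) t) (at t within I)))"

definition smooth_W_curve ::
    "real^'n^'n \<Rightarrow> real \<Rightarrow> real^'m^'n \<Rightarrow> real^'m^'n \<Rightarrow>
     (real \<Rightarrow> real^'m^'n) \<Rightarrow> (real \<Rightarrow> real^'m^'n) \<Rightarrow> bool" where
  "smooth_W_curve k T Q0 QT Q P \<longleftrightarrow>
     smooth_curve_on {0..T} (\<lambda>t. (Q t, P t)) \<and>
     (\<forall>t\<in>{0..T}. (Q t, P t) \<in> W k) \<and> Q 0 = Q0 \<and> Q T = QT"

definition extremal_trajectory ::
    "real^'m^'m \<Rightarrow> real^'n^'n \<Rightarrow> real \<Rightarrow> real^'m^'n \<Rightarrow> real^'m^'n \<Rightarrow>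
     (real \<Rightarrow> real^'m^'n) \<Rightarrow> (real \<Rightarrow> real^'m^'n) \<Rightarrow> (real \<Rightarrow> real^'m^'m) \<Rightarrow> bool" where
  "extremal_trajectory \<Lambda> k T Q0 QT Q P U \<longleftrightarrow>
     smooth_W_curve k T Q0 QT Q P \<and>
     (\<forall>t\<in>{0..T}.
        U t \<in> skew_matrices \<and>
        (\<exists>X. ((\<lambda>s. (Q s, P s)) has_vector_derivative X) (at t within {0..T}) \<and>
             is_hamiltonian_vector (\<lambda>(q, p). hamiltonian \<Lambda> p q (U t)) (Q t, P t) X) \<and>
        is_gradient_on_skew (\<lambda>u. hamiltonian \<Lambda> (P t) (Q t) u) (U t) 0)"

end

theory Submission
  imports Defs
begin

text \<open>
  On the ambient space, the Hamiltonian vector field of \<open>H\<close> with \<open>U\<close> fixed is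
  \<open>(Q U, P U - Q U \<Lambda> U)\<close>, which is not tangent to \<open>W k\<close>. Adding \<open>(0, Q U \<Lambda> U Q\<^sup>T Q)\<close> makes it
  tangent and does not change its symplectic pairing with tangent vectors: the pairing of
  \<open>(0, B Q)\<close> with \<open>B\<close> symmetric against \<open>(Q U\<^sub>1, _)\<close> is the trace of a symmetric times a skew
  matrix. The result is \<open>(Q U, P U - Q A)\<close>. As the form is nondegenerate on the tangent space, no
  other tangent vector is Hamiltonian. The remaining equation is the vanishing of the skew part
  of the gradient of \<open>H\<close> in \<open>U\<close>.
\<close>

section \<open>Matrix products, transposes and the trace inner product\<close>

lemma bounded_bilinear_matrix_mult:
  "bounded_bilinear ((**) :: real^'b^'a \<Rightarrow> real^'c^'b \<Rightarrow> real^'c^'a)"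
proof -
  have "bilinear ((**) :: real^'b^'a \<Rightarrow> real^'c^'b \<Rightarrow> real^'c^'a)"
    unfolding bilinear_def
    by (auto intro!: linearI simp: vec_eq_iff matrix_matrix_mult_def sum.distrib
        distrib_left distrib_right sum_distrib_left mult_ac)
  then show ?thesis
    by (simp add: bilinear_conv_bounded_bilinear)
qed

lemmas matrix_mult_distribs =
  bounded_bilinear.add_left [OF bounded_bilinear_matrix_mult]
  bounded_bilinear.add_right [OF bounded_bilinear_matrix_mult]
  bounded_bilinear.diff_left [OF bounded_bilinear_matrix_mult]
  bounded_bilinear.diff_right [OF bounded_bilinear_matrix_mult]
  bounded_bilinear.minus_left [OF bounded_bilinear_matrix_mult]
  bounded_bilinear.minus_right [OF bounded_bilinear_matrix_mult]

lemma transpose_add: "transpose (A + B) = transpose A + transpose (B :: 'a::ab_group_add^'n^'m)"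
  and transpose_diff: "transpose (A - B) = transpose A - transpose B"
  and transpose_minus: "transpose (- A) = - transpose A"
  by (simp_all add: transpose_def vec_eq_iff)

lemmas transpose_distribs = transpose_add transpose_diff transpose_minus matrix_transpose_mul

lemma mat_inner_eq_inner: "mat_inner A B = A \<bullet> B"
  unfolding mat_inner_def trace_def matrix_matrix_mult_def transpose_def inner_vec_def
  by (simp add: sum.swap [of _ "UNIV :: 'a set"])

lemma inner_matrix_mult_left:
  fixes C :: "real^'c^'a"
  shows "C \<bullet> (A ** B) = (transpose A ** C) \<bullet> B"
  unfolding mat_inner_eq_inner [symmetric] mat_inner_def
  by (simp add: matrix_transpose_mul matrix_mul_assoc)

lemma inner_transpose_transpose: "transpose A \<bullet> transpose B = A \<bullet> (B :: real^'c^'a)"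
  unfolding inner_vec_def transpose_def
  by (simp add: sum.swap [of _ "UNIV :: 'c set"])

lemma inner_matrix_mult_right:
  fixes C :: "real^'c^'a"
  shows "C \<bullet> (A ** B) = (C ** transpose B) \<bullet> A"
  using inner_matrix_mult_left [of "transpose C" "transpose B" "transpose A"]
  by (metis inner_transpose_transpose matrix_transpose_mul transpose_transpose)

text \<open>Transposition preserves the inner product, which makes symmetric and skew matrices
  orthogonal. For the forward direction \<open>M - transpose M\<close> serves as the test matrix:
  its inner products with \<open>M\<close> and with \<open>transpose M\<close> both vanish, hence so
  does its norm.\<close>

lemma skew_part_eq_0_iff:
  fixes M :: "real^'m^'m"
  shows "(\<forall>V \<in> skew_matrices. M \<bullet> V = 0) \<longleftrightarrow> M = transpose M"
proof
  assume "\<forall>V \<in> skew_matrices. M \<bullet> V = 0"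
  moreover have "M - transpose M \<in> skew_matrices"
    by (simp add: skew_matrices_def transpose_distribs)
  ultimately have *: "M \<bullet> (M - transpose M) = 0"
    by blast
  then have "transpose M \<bullet> (M - transpose M) = 0"
    using inner_transpose_transpose [of M "M - transpose M"]
    by (simp add: transpose_distribs inner_diff_right)
  with * have "(M - transpose M) \<bullet> (M - transpose M) = 0"
    by (simp add: inner_diff_left)
  then show "M = transpose M"
    by simp
next
  assume sym: "M = transpose M"
  show "\<forall>V \<in> skew_matrices. M \<bullet> V = 0"
  proof
    fix V :: "real^'m^'m"
    assume "V \<in> skew_matrices"
    then have "M \<bullet> V = - (M \<bullet> V)"
      using inner_transpose_transpose [of M V] sym by (simp add: skew_matrices_def)
    then show "M \<bullet> V = 0"
      by simp
  qed
qed

section \<open>Differentials of the Hamiltonian and the optimality of the control\<close>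

lemma has_derivative_hamiltonian_state:
  fixes q p :: "real^'m^'n"
  shows "((\<lambda>(q, p). hamiltonian \<Lambda> p q U) has_derivative
     (\<lambda>(y, x). p \<bullet> (y ** U) + x \<bullet> (q ** U)
        - ((q ** U ** \<Lambda>) \<bullet> (y ** U) + (y ** U ** \<Lambda>) \<bullet> (q ** U)) / 2)) (at (q, p))"
  unfolding hamiltonian_def running_cost_def mat_inner_eq_inner case_prod_unfold
  by (auto intro!: derivative_eq_intros
      bounded_linear.has_derivative [OF bounded_bilinear.bounded_linear_left
        [OF bounded_bilinear_matrix_mult]]
      simp: inner_commute)

lemma has_derivative_hamiltonian_control:
  fixes q p :: "real^'m^'n"
  shows "(hamiltonian \<Lambda> p q has_derivative
     (\<lambda>V. p \<bullet> (q ** V)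
        - ((q ** U ** \<Lambda>) \<bullet> (q ** V) + (q ** V ** \<Lambda>) \<bullet> (q ** U)) / 2)) (at U)"
  unfolding hamiltonian_def running_cost_def mat_inner_eq_inner
  by (auto intro!: derivative_eq_intros
      bounded_linear.has_derivative [OF bounded_bilinear.bounded_linear_left
        [OF bounded_bilinear_matrix_mult]]
      bounded_linear.has_derivative [OF bounded_bilinear.bounded_linear_right
        [OF bounded_bilinear_matrix_mult]])

text \<open>The gradient in \<open>U\<close> over all matrices is \<open>?M\<close>, so the
  restricted gradient vanishes exactly when \<open>?M\<close> is symmetric. Transposing
  \<open>?M\<close> turns its last term into \<open>+ \<Lambda> ** U ** (transpose q ** q)\<close>
  because \<open>U\<close> is skew; collecting terms gives the equation.\<close>

lemma is_gradient_hamiltonian_iff: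
  fixes q p :: "real^'m^'n"
  assumes \<Lambda>: "transpose \<Lambda> = \<Lambda>" and U: "U \<in> skew_matrices"
  shows "is_gradient_on_skew (\<lambda>u. hamiltonian \<Lambda> p q u) U 0 \<longleftrightarrow>
    transpose q ** p - transpose p ** q =
      transpose q ** q ** U ** \<Lambda> + \<Lambda> ** U ** (transpose q ** q)"
proof -
  let ?M = "transpose q ** p - transpose q ** q ** U ** \<Lambda>"
  have "frechet_derivative (hamiltonian \<Lambda> p q) (at U) V = ?M \<bullet> V" for V
  proof -
    \<comment> \<open>Symmetry of \<open>\<Lambda>\<close> makes the two product-rule terms of the
      quadratic cost equal, which cancels the factor one half.\<close>
    have "(q ** V ** \<Lambda>) \<bullet> (q ** U) = (q ** U ** \<Lambda>) \<bullet> (q ** V)"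
      using \<Lambda> by (metis inner_commute inner_matrix_mult_right)
    then show ?thesis
      unfolding frechet_derivative_at [OF has_derivative_hamiltonian_control, symmetric]
      by (simp add: inner_matrix_mult_left [of _ q] inner_diff_left matrix_mul_assoc)
  qed
  moreover have "(0 :: real^'m^'m) \<in> skew_matrices"
    by (simp add: skew_matrices_def vec_eq_iff transpose_def)
  ultimately have "is_gradient_on_skew (\<lambda>u. hamiltonian \<Lambda> p q u) U 0 \<longleftrightarrow> ?M = transpose ?M"
    by (simp add: is_gradient_on_skew_def mat_inner_eq_inner skew_part_eq_0_iff)
  also have "transpose ?M = transpose p ** q + \<Lambda> ** U ** (transpose q ** q)"
    using \<Lambda> U by (simp add: skew_matrices_def transpose_distribs matrix_mult_distribs matrix_mul_assoc)
  also have "?M = \<dots> \<longleftrightarrow> transpose q ** p - transpose p ** q =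
      transpose q ** q ** U ** \<Lambda> + \<Lambda> ** U ** (transpose q ** q)"
    by (auto simp: algebra_simps)
  finally show ?thesis .
qed

section \<open>Nondegeneracy of the form and uniqueness of Hamiltonian vectors\<close>

lemma eq_uminus_iff_0: "x = - x \<longleftrightarrow> x = 0" for x :: "'a::real_vector"
proof
  assume "x = - x"
  then have "2 *\<^sub>R x = 0"
    by (metis add.right_inverse scaleR_2)
  then show "x = 0"
    by simp
qed simp

text \<open>Test vectors with first component zero force \<open>q ** U = 0\<close>; the remaining
  ones then force the second component \<open>D\<close> to vanish. Both times a matrix X is found to
  satisfy X = - X \<open>transpose q\<close> \<open>q\<close>; multiplying by
  \<open>transpose q\<close> on the right makes X \<open>transpose q\<close> its own negative, so it
  is zero, and hence X is zero.\<close>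

lemma sympl_form_nondegenerate:
  fixes q p :: "real^'m^'n"
  assumes q: "q ** transpose q = mat 1"
    and Z: "Z \<in> W_tangent (q, p)"
    and 0: "\<And>Y. Y \<in> W_tangent (q, p) \<Longrightarrow> sympl_form Z Y = 0"
  shows "Z = 0"
proof -
  obtain U V where UV: "U \<in> skew_matrices" "V \<in> skew_matrices"
    and Z_eq: "Z = (q ** U, p ** U + q ** V)"
    using Z unfolding W_tangent_def by auto
  define D where "D = p ** U + q ** V"
  have zero_skew: "(0 :: real^'m^'m) \<in> skew_matrices"
    by (simp add: skew_matrices_def vec_eq_iff transpose_def)
  have form: "(q ** U) \<bullet> (p ** U' + q ** V') - D \<bullet> (q ** U') = 0"
    if "U' \<in> skew_matrices" "V' \<in> skew_matrices" for U' V'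
    using 0 [of "(q ** U', p ** U' + q ** V')"] that
    unfolding W_tangent_def Z_eq sympl_form_def mat_inner_eq_inner D_def by auto
  \<comment> \<open>The choice \<open>U' = 0\<close> leaves only the pairing of
    \<open>q ** U\<close> with \<open>q ** V'\<close>.\<close>
  have "\<forall>V' \<in> skew_matrices. (transpose q ** (q ** U)) \<bullet> V' = 0"
    using form [OF zero_skew] by (simp add: inner_matrix_mult_left)
  then have "transpose q ** (q ** U) = transpose (transpose q ** (q ** U))"
    by (simp only: skew_part_eq_0_iff)
  also have "\<dots> = - (U ** transpose q ** q)"
    using UV by (simp add: skew_matrices_def transpose_distribs matrix_mult_distribs)
  finally have sym: "transpose q ** (q ** U) = - (U ** transpose q ** q)" .
  have "q ** U = q ** (transpose q ** (q ** U))"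
    by (simp add: matrix_mul_assoc q)
  then have qU: "q ** U = - (q ** U ** transpose q ** q)"
    unfolding sym by (simp add: matrix_mult_distribs matrix_mul_assoc)
  then have "q ** U ** transpose q = - (q ** U ** transpose q ** (q ** transpose q))"
    by (metis bounded_bilinear.minus_left [OF bounded_bilinear_matrix_mult] matrix_mul_assoc)
  then have "q ** U ** transpose q = 0"
    by (simp add: q eq_uminus_iff_0)
  with qU have qU0: "q ** U = 0"
    by simp
  \<comment> \<open>Since \<open>q ** U\<close> is zero, the choice \<open>V' = 0\<close> leaves
    only the pairing of \<open>D\<close> with \<open>q ** U'\<close>, whatever
    \<open>p ** U'\<close> is.\<close>
  have "\<forall>U' \<in> skew_matrices. (transpose q ** D) \<bullet> U' = 0"
    using form [OF _ zero_skew] by (simp add: inner_matrix_mult_left qU0)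
  then have "transpose q ** D = transpose (transpose q ** D)"
    by (simp only: skew_part_eq_0_iff)
  then have sym: "transpose q ** D = transpose D ** q"
    by (simp add: transpose_distribs)
  \<comment> \<open>Symmetry of \<open>transpose q ** D\<close> does not yet determine
    \<open>D\<close>. Tangency supplies the rest: the term with \<open>p\<close> drops out of
    \<open>D ** transpose q\<close>, leaving the skew matrix
    \<open>q ** V ** transpose q\<close>.\<close>
  have "transpose (q ** U) = 0"
    by (simp add: qU0 vec_eq_iff transpose_def)
  then have "U ** transpose q = 0"
    using UV by (simp add: skew_matrices_def transpose_distribs matrix_mult_distribs)
  then have D_q: "D ** transpose q = q ** V ** transpose q"
    by (simp add: D_def matrix_mult_distribs flip: matrix_mul_assoc)
  then have "q ** transpose D = transpose (q ** V ** transpose q)"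
    by (metis matrix_transpose_mul transpose_transpose)
  also have "\<dots> = - (D ** transpose q)"
    unfolding D_q using UV
    by (simp add: skew_matrices_def transpose_distribs matrix_mult_distribs matrix_mul_assoc)
  finally have q_D: "q ** transpose D = - (D ** transpose q)" .
  have "D = q ** (transpose q ** D)"
    by (simp add: matrix_mul_assoc q)
  then have D: "D = - (D ** transpose q ** q)"
    unfolding sym by (simp add: matrix_mult_distribs matrix_mul_assoc q_D)
  then have "D ** transpose q = - (D ** transpose q ** (q ** transpose q))"
    by (metis bounded_bilinear.minus_left [OF bounded_bilinear_matrix_mult] matrix_mul_assoc)
  then have "D ** transpose q = 0"
    by (simp add: q eq_uminus_iff_0)
  with D have "D = 0"
    by simp
  with qU0 show ?thesis
    by (simp add: Z_eq D_def zero_prod_def)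
qed

lemma W_tangent_diff:
  assumes "X \<in> W_tangent z" "Y \<in> W_tangent z"
  shows "X - Y \<in> W_tangent z"
proof -
  obtain q p where z: "z = (q, p)"
    by (cases z)
  obtain U V U' V' where *: "X = (q ** U, p ** U + q ** V)" "Y = (q ** U', p ** U' + q ** V')"
    "U \<in> skew_matrices" "V \<in> skew_matrices" "U' \<in> skew_matrices" "V' \<in> skew_matrices"
    using assms unfolding z W_tangent_def by auto
  have "X - Y = (q ** (U - U'), p ** (U - U') + q ** (V - V'))"
    by (simp add: * matrix_mult_distribs)
  moreover have "U - U' \<in> skew_matrices" "V - V' \<in> skew_matrices"
    using * by (simp_all add: skew_matrices_def transpose_distribs)
  ultimately show ?thesis
    unfolding z W_tangent_def by auto
qed

text \<open>The difference of two candidates is again tangent and pairs to zero with every tangent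
  vector, so nondegeneracy applies.\<close>

lemma is_hamiltonian_vector_unique:
  fixes q p :: "real^'m^'n"
  assumes "q ** transpose q = mat 1"
    and X: "is_hamiltonian_vector F (q, p) X" and Y: "is_hamiltonian_vector F (q, p) Y"
  shows "X = Y"
proof -
  have "X - Y = 0"
  proof (rule sympl_form_nondegenerate)
    show "X - Y \<in> W_tangent (q, p)"
      using X Y by (auto simp: is_hamiltonian_vector_def intro: W_tangent_diff)
    fix Z
    assume "Z \<in> W_tangent (q, p)"
    then have "sympl_form X Z = sympl_form Y Z"
      using X Y by (simp add: is_hamiltonian_vector_def)
    then show "sympl_form (X - Y) Z = 0"
      by (simp add: sympl_form_def mat_inner_eq_inner case_prod_unfold inner_diff_left)
  qed fact
  then show ?thesis
    by simp
qed

section \<open>The explicit Hamiltonian vector\<close>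

lemma is_hamiltonian_vector_hamiltonian:
  fixes q p :: "real^'m^'n"
  assumes q: "q ** transpose q = mat 1"
    and \<Lambda>: "transpose \<Lambda> = \<Lambda>" and U: "U \<in> skew_matrices"
    and A: "A = transpose q ** q ** U ** \<Lambda> ** U - U ** \<Lambda> ** U ** (transpose q ** q)"
  shows "is_hamiltonian_vector (\<lambda>(q, p). hamiltonian \<Lambda> p q U) (q, p) (q ** U, p ** U - q ** A)"
  unfolding is_hamiltonian_vector_def
proof (intro conjI ballI)
  have tU: "transpose U = - U"
    using U by (simp add: skew_matrices_def)
  \<comment> \<open>\<open>U ** \<Lambda> ** U\<close> is symmetric, so the second term of
    \<open>A\<close> is the transpose of the first. Thus \<open>- A\<close> can serve as the second
    skew parameter of the tangent vector.\<close>
  have "- A \<in> skew_matrices"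
    by (simp add: A \<Lambda> tU skew_matrices_def transpose_distribs matrix_mult_distribs matrix_mul_assoc)
  moreover have "p ** U - q ** A = p ** U + q ** (- A)"
    by (simp add: matrix_mult_distribs)
  ultimately show "(q ** U, p ** U - q ** A) \<in> W_tangent (q, p)"
    unfolding W_tangent_def using U by blast
  \<comment> \<open>\<open>B ** q\<close> is the correction that makes the ambient Hamiltonian
    vector tangent; \<open>q ** transpose q = mat 1\<close> separates it from the rest of
    \<open>q ** A\<close>.\<close>
  define B where "B = q ** U ** \<Lambda> ** U ** transpose q"
  have qA: "q ** A = q ** U ** \<Lambda> ** U - B ** q"
    by (simp add: A B_def matrix_mult_distribs matrix_mul_assoc q)
  have B: "transpose B = B"
    by (simp add: B_def \<Lambda> tU transpose_distribs matrix_mult_distribs matrix_mul_assoc)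
  fix Y
  assume "Y \<in> W_tangent (q, p)"
  then obtain U1 V1 where U1: "U1 \<in> skew_matrices"
    and Y: "Y = (q ** U1, p ** U1 + q ** V1)"
    unfolding W_tangent_def by auto
  obtain y x where yx: "Y = (y, x)"
    by (cases Y)
  have "(B ** q) \<bullet> y = (transpose q ** B ** q) \<bullet> U1"
    using Y yx by (simp add: inner_matrix_mult_left matrix_mul_assoc)
  also have "transpose q ** B ** q = transpose (transpose q ** B ** q)"
    by (simp add: B transpose_distribs matrix_mul_assoc)
  then have "(transpose q ** B ** q) \<bullet> U1 = 0"
    using U1 skew_part_eq_0_iff by blast
  finally have By: "y \<bullet> (B ** q) = 0"
    by (simp add: inner_commute)
  \<comment> \<open>Merge the two quadratic terms, then move \<open>U\<close> off \<open>y\<close>;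
    each move changes the sign because \<open>U\<close> is skew. What results is the ambient vector
    paired with \<open>Y\<close>.\<close>
  have "(y ** U ** \<Lambda>) \<bullet> (q ** U) = (q ** U ** \<Lambda>) \<bullet> (y ** U)"
    using \<Lambda> by (metis inner_commute inner_matrix_mult_right)
  moreover have "(q ** U ** \<Lambda>) \<bullet> (y ** U) = - ((q ** U ** \<Lambda> ** U) \<bullet> y)"
    "p \<bullet> (y ** U) = - ((p ** U) \<bullet> y)"
    by (simp_all add: inner_matrix_mult_right [of _ y] tU matrix_mult_distribs)
  ultimately show "frechet_derivative (\<lambda>(q, p). hamiltonian \<Lambda> p q U) (at (q, p)) Y =
      sympl_form (q ** U, p ** U - q ** A) Y"
    unfolding frechet_derivative_at [OF has_derivative_hamiltonian_state, symmetric]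
    by (simp add: yx sympl_form_def mat_inner_eq_inner qA By inner_diff_right inner_commute)
qed

section \<open>From Hamiltonian vectors at each time to trajectories\<close>

lemma has_vector_derivative_Pair_iff:
  "((\<lambda>s. (f s, g s)) has_vector_derivative (f', g')) (at t within I) \<longleftrightarrow>
    (f has_vector_derivative f') (at t within I) \<and> (g has_vector_derivative g') (at t within I)"
  (is "?pair \<longleftrightarrow> ?components")
proof
  assume pair: ?pair
  show ?components
    using bounded_linear.has_vector_derivative [OF bounded_linear_fst pair]
      bounded_linear.has_vector_derivative [OF bounded_linear_snd pair] by simp
qed (simp add: has_vector_derivative_Pair)

theorem theorem4:
  fixes \<Lambda> :: "real^'m^'m" and k :: "real^'n^'n" and T :: real
    and Q0 QT :: "real^'m^'n"
    and Q P :: "real \<Rightarrow> real^'m^'n" and U :: "real \<Rightarrow> real^'m^'m"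
  assumes "CARD('n) \<le> CARD('m)"
    and "diagonal_matrix \<Lambda>" and "positive_definite \<Lambda>"
    and "symmetric_matrix k"
    and "0 < T"
  shows "extremal_trajectory \<Lambda> k T Q0 QT Q P U \<longleftrightarrow>
    smooth_W_curve k T Q0 QT Q P \<and>
    (\<forall>t\<in>{0..T}.
       U t \<in> skew_matrices \<and>
       (Q has_vector_derivative Q t ** U t) (at t within {0..T}) \<and>
       (let S = transpose (Q t) ** Q t;
            A = S ** U t ** \<Lambda> ** U t - U t ** \<Lambda> ** U t ** S
        in (P has_vector_derivative P t ** U t - Q t ** A) (at t within {0..T}) \<and>
           transpose (Q t) ** P t - transpose (P t) ** Q t = S ** U t ** \<Lambda> + \<Lambda> ** U t ** S))"
proof -
  have \<Lambda>: "transpose \<Lambda> = \<Lambda>"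
    using \<open>positive_definite \<Lambda>\<close> by (simp add: positive_definite_def symmetric_matrix_def)
  \<comment> \<open>From left to right, uniqueness identifies the velocity \<open>X\<close> with the
    explicit vector; from right to left, the explicit vector is the witness for
    \<open>X\<close>.\<close>
  have velocity: "(\<exists>X. ((\<lambda>s. (Q s, P s)) has_vector_derivative X) (at t within {0..T}) \<and>
       is_hamiltonian_vector (\<lambda>(q, p). hamiltonian \<Lambda> p q (U t)) (Q t, P t) X) \<longleftrightarrow>
     (Q has_vector_derivative Q t ** U t) (at t within {0..T}) \<and>
     (P has_vector_derivative P t ** U t - Q t **
       (transpose (Q t) ** Q t ** U t ** \<Lambda> ** U t -
        U t ** \<Lambda> ** U t ** (transpose (Q t) ** Q t))) (at t within {0..T})"
    if "(Q t, P t) \<in> W k" "U t \<in> skew_matrices" for t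
  proof -
    have "Q t ** transpose (Q t) = mat 1"
      using that by (simp add: W_def)
    note is_hamiltonian_vector_unique [OF this]
      is_hamiltonian_vector_hamiltonian [OF this \<Lambda> that(2) refl]
    then show ?thesis
      unfolding has_vector_derivative_Pair_iff [symmetric] by blast
  qed
  \<comment> \<open>Both sides of the equivalence contain \<open>smooth_W_curve\<close>, so the
    constraint needed for \<open>velocity\<close> is available in either direction.\<close>
  have "(Q t, P t) \<in> W k" if "smooth_W_curve k T Q0 QT Q P" "t \<in> {0..T}" for t
    using that by (simp add: smooth_W_curve_def)
  then show ?thesis
    unfolding extremal_trajectory_def Let_def
    using velocity is_gradient_hamiltonian_iff [OF \<Lambda>] by blast
qed

end
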